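(* The bidual $X^{**}$ of every infinite-dimensional Lindenstrauss space $X$ has the strong diameter 2 property. In particular, every infinite-dimensional Lindenstrauss space has the strong diameter 2 property.
   Context: All Banach spaces are real. A Lindenstrauss space is a Banach space $X$ whose dual $X^{*}$ is (isometrically) an $L_1(\mu)$-space for some positive measure $\mu$. For a Banach space $Z$ with closed unit ball $B_Z$, a slice of $B_Z$ is a set $S(z^{*},\varepsilon)=\{z\in B_Z: z^{*}(z)>1-\varepsilon\}$, where $z^{*}\in Z^{*}$, $\|z^{*}\|=1$ and $\varepsilon>0$. A finite convex combination of slices of $B_Z$ is a set of the form $\sum_{i=1}^{n}\lambda_i S(z_i^{*},\varepsilon_i)$ (Minkowski sum) with $\lambda_i\ge 0$, $\sum_{i=1}^{n}\lambda_i=1$, $\|z_i^{*}\|=1$ and $\varepsilon_i>0$. $Z$ has the strong diameter 2 property if every finite convex combination of slices of $B_Z$ has diameter 2. *)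

theory Defs
  imports "HOL-Analysis.Analysis"
begin

text \<open>A normed space is represented by its type, so properties of a space take an argument
  of type \<^typ>\<open>'a itself\<close>. The dual of \<^typ>\<open>'a\<close> is \<^typ>\<open>'a \<Rightarrow>\<^sub>L real\<close> with the operator norm.\<close>

definition infinite_dimensional :: "'a::real_vector itself \<Rightarrow> bool" where
  "infinite_dimensional _ \<longleftrightarrow> \<not> (\<exists>B::'a set. finite B \<and> span B = UNIV)"

definition L1_space :: "'b measure \<Rightarrow> ('b \<Rightarrow> real) set set" where
  "L1_space M = {f. integrable M f} //
     {(f, g). integrable M f \<and> integrable M g \<and> (AE x in M. f x = g x)}"

text \<open>The vector space operations and the norm of \<^term>\<open>L1_space M\<close> are computed on arbitrary
  representatives; linearity and isometry of \<open>T\<close> are expressed through them.\<close>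

definition isometric_to_L1 :: "'z::real_normed_vector itself \<Rightarrow> 'b measure \<Rightarrow> bool" where
  "isometric_to_L1 _ M \<longleftrightarrow>
     (\<exists>T :: 'z \<Rightarrow> ('b \<Rightarrow> real) set.
        bij_betw T UNIV (L1_space M) \<and>
        (\<forall>u v. \<forall>f\<in>T u. \<forall>g\<in>T v. (\<lambda>x. f x + g x) \<in> T (u + v)) \<and>
        (\<forall>c u. \<forall>f\<in>T u. (\<lambda>x. c * f x) \<in> T (c *\<^sub>R u)) \<and>
        (\<forall>u. \<forall>f\<in>T u. norm u = (\<integral>x. \<bar>f x\<bar> \<partial>M)))"

text \<open>HOL cannot quantify over the type of points of the measure space inside a formula, so
  that type is a second argument. As a hypothesis with \<^typ>\<open>'b\<close> free and not occurring in the
  conclusion, the predicate says that the dual is an \<open>L\<^sub>1\<close>-space over some measure space.\<close>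

definition lindenstrauss_space :: "'a::banach itself \<Rightarrow> 'b itself \<Rightarrow> bool" where
  "lindenstrauss_space _ _ \<longleftrightarrow> (\<exists>M :: 'b measure. isometric_to_L1 TYPE('a \<Rightarrow>\<^sub>L real) M)"

definition slice :: "('z::real_normed_vector \<Rightarrow>\<^sub>L real) \<Rightarrow> real \<Rightarrow> 'z set" where
  "slice \<phi> \<epsilon> = {z \<in> cball 0 1. blinfun_apply \<phi> z > 1 - \<epsilon>}"

definition convex_combination_of_slices ::
  "nat \<Rightarrow> (nat \<Rightarrow> real) \<Rightarrow> (nat \<Rightarrow> 'z::real_normed_vector \<Rightarrow>\<^sub>L real) \<Rightarrow> (nat \<Rightarrow> real) \<Rightarrow> 'z set" where
  "convex_combination_of_slices n c \<phi> \<epsilon> =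
     {(\<Sum>i<n. c i *\<^sub>R z i) | z. \<forall>i<n. z i \<in> slice (\<phi> i) (\<epsilon> i)}"

definition strong_diameter_2_property :: "'z::real_normed_vector itself \<Rightarrow> bool" where
  "strong_diameter_2_property _ \<longleftrightarrow>
     (\<forall>n c (\<phi> :: nat \<Rightarrow> 'z \<Rightarrow>\<^sub>L real) \<epsilon>.
        (\<forall>i<n. c i \<ge> 0 \<and> norm (\<phi> i) = 1 \<and> \<epsilon> i > 0) \<and> (\<Sum>i<n. c i) = 1 \<longrightarrow>
        diameter (convex_combination_of_slices n c \<phi> \<epsilon>) = 2)"

end

theory Submission imports Defs
begin

text \<open>
  Write \<open>E\<close> for the dual of \<open>X\<close>, an \<open>L\<^sub>1\<close>-space. The idea is that a functional on \<open>E\<close> can be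
  changed at will on a small part of the measure space, with little effect on any finite number of
  given elements of the bidual of \<open>E\<close>, and that this change alone makes two functionals differ
  by 2 in norm.

  In detail, let \<open>D 0, D 1, \<dots>\<close> be disjoint sets of the measure space that carry nonzero
  functions. Restriction to \<open>D k\<close> is a projection \<open>p k\<close> of \<open>E\<close> with
  \<open>\<parallel>u\<parallel> = \<parallel>p k u\<parallel> + \<parallel>u - p k u\<parallel>\<close>. Choose points \<open>z i\<close> of the given slices of the ball of the
  dual of \<open>E\<close>, a unit vector \<open>u\<close> in the range of \<open>p k\<close>, and a functional \<open>\<psi>\<close> of norm at
  most 1 with \<open>\<psi> u = 1\<close>. The functionals \<open>z i \<circ> (1 - p k) \<plusminus> \<psi> \<circ> p k\<close> have norm at most 1
  by the norm identity, and have the values \<open>\<plusminus>1\<close> at \<open>u\<close> whatever \<open>i\<close> is. Therefore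
  the two convex combinations that they form are at distance 2. The functionals lie in the slices when \<open>k\<close>
  is large: functionals on \<open>E\<close> that live on disjoint sets behave like the unit vectors of \<open>c\<^sub>0\<close>,
  so every element of the bidual of \<open>E\<close> tends to 0 along a bounded sequence of them
  (\<open>functional_tendsto_0_on_disjoint\<close>, \<open>strong_diameter_2_property_dual\<close>).

  The sets \<open>D k\<close> exist because \<open>E\<close> is infinite-dimensional (\<open>infinite_dimensional_dual\<close>,
  from the Hahn--Banach theorem), so that the measure space can be split again and again
  (\<open>split_large\<close>).

  The property passes from the bidual to \<open>X\<close> because the distance of two points of the bidual
  is nearly attained at a single element of \<open>E\<close>: each point need only be approximated by an
  element of the ball of \<open>X\<close> at that element and at the functional that defines its slice
  (\<open>bidual_ball_approximation\<close>, a case of Goldstine's theorem).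
\<close>

section \<open>The Hahn--Banach theorem through minimal sublinear functionals\<close>

text \<open>Homogeneity is required only as an inequality, the form that is checked directly for infima;
  equality follows in \<open>sublinear_scale\<close>.\<close>

definition sublinear :: "('a::real_vector \<Rightarrow> real) \<Rightarrow> bool" where
  "sublinear p \<longleftrightarrow> (\<forall>x y. p (x + y) \<le> p x + p y) \<and> (\<forall>c\<ge>0. \<forall>x. p (c *\<^sub>R x) \<le> c * p x)"

text \<open>This is the largest sublinear functional below \<open>p\<close> whose value at \<open>- y\<close> is at most
  \<open>- p y\<close>, when \<open>p\<close> is sublinear. It serves twice: to show that minimal sublinear functionals
  are odd, and to force a value at a prescribed vector.\<close>

definition tilt :: "('a::real_vector \<Rightarrow> real) \<Rightarrow> 'a \<Rightarrow> 'a \<Rightarrow> real" where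
  "tilt p y x = (INF t\<in>{0..}. p (x + t *\<^sub>R y) - t * p y)"

lemma sublinear_add: "sublinear p \<Longrightarrow> p (x + y) \<le> p x + p y"
  by (simp add: sublinear_def)

lemma sublinear_zero:
  assumes "sublinear p"
  shows "p 0 = 0"
proof (rule antisym)
  have "p (0 *\<^sub>R 0) \<le> 0 * p 0"
    using assms unfolding sublinear_def by blast
  then show "p 0 \<le> 0" by simp
  show "0 \<le> p 0"
    using sublinear_add[OF assms, of 0 0] by simp
qed

lemma sublinear_scale:
  assumes "sublinear p" "c \<ge> 0"
  shows "p (c *\<^sub>R x) = c * p x"
proof (cases "c = 0")
  case True
  then show ?thesis using sublinear_zero[OF assms(1)] by simp
next
  case False
  then have "c > 0" using assms(2) by simp
  have "p ((1 / c) *\<^sub>R (c *\<^sub>R x)) \<le> (1 / c) * p (c *\<^sub>R x)"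
    using assms(1) \<open>c > 0\<close> unfolding sublinear_def by (metis less_eq_real_def zero_less_divide_1_iff)
  then have "c * p x \<le> p (c *\<^sub>R x)"
    using \<open>c > 0\<close> by (simp add: field_simps)
  moreover have "p (c *\<^sub>R x) \<le> c * p x"
    using assms unfolding sublinear_def by blast
  ultimately show ?thesis by simp
qed

lemma sublinear_uminus: "sublinear p \<Longrightarrow> - p (- x) \<le> p x"
  using sublinear_add[of p x "- x"] sublinear_zero[of p] by simp

lemma tilt_le:
  assumes "sublinear p" "t \<ge> 0"
  shows "tilt p y x \<le> p (x + t *\<^sub>R y) - t * p y"
  unfolding tilt_def
proof (rule cINF_lower)
  show "bdd_below ((\<lambda>t. p (x + t *\<^sub>R y) - t * p y) ` {0..})"
  proof (rule bdd_belowI2)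
    fix s :: real assume "s \<in> {0..}"
    then have "s * p y = p ((x + s *\<^sub>R y) + (- x))"
      using sublinear_scale[OF assms(1)] by simp
    also have "\<dots> \<le> p (x + s *\<^sub>R y) + p (- x)"
      by (rule sublinear_add[OF assms(1)])
    finally show "- p (- x) \<le> p (x + s *\<^sub>R y) - s * p y" by simp
  qed
qed (use assms(2) in simp)

lemma le_tiltI: "(\<And>t. t \<ge> 0 \<Longrightarrow> a \<le> p (x + t *\<^sub>R y) - t * p y) \<Longrightarrow> a \<le> tilt p y x"
  unfolding tilt_def by (rule cINF_greatest) auto

lemma sublinear_tilt:
  assumes p: "sublinear p"
  shows "sublinear (tilt p y)"
  unfolding sublinear_def
proof (intro conjI allI impI)
  fix u v
  have *: "tilt p y (u + v) \<le> (p (u + s *\<^sub>R y) - s * p y) + (p (v + t *\<^sub>R y) - t * p y)"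
    if "s \<ge> 0" "t \<ge> 0" for s t
  proof -
    have "tilt p y (u + v) \<le> p ((u + v) + (s + t) *\<^sub>R y) - (s + t) * p y"
      using that by (intro tilt_le p) simp
    also have "(u + v) + (s + t) *\<^sub>R y = (u + s *\<^sub>R y) + (v + t *\<^sub>R y)"
      by (simp add: algebra_simps)
    also have "p \<dots> \<le> p (u + s *\<^sub>R y) + p (v + t *\<^sub>R y)"
      by (rule sublinear_add[OF p])
    finally show ?thesis by (simp add: algebra_simps)
  qed
  have "tilt p y (u + v) - tilt p y v \<le> tilt p y u"
  proof (rule le_tiltI)
    fix s :: real assume "s \<ge> 0"
    have "tilt p y (u + v) - (p (u + s *\<^sub>R y) - s * p y) \<le> tilt p y v"
      by (rule le_tiltI) (use *[OF \<open>s \<ge> 0\<close>] in \<open>simp add: algebra_simps\<close>)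
    then show "tilt p y (u + v) - tilt p y v \<le> p (u + s *\<^sub>R y) - s * p y" by simp
  qed
  then show "tilt p y (u + v) \<le> tilt p y u + tilt p y v" by simp
next
  fix c :: real and x assume "c \<ge> 0"
  have *: "tilt p y (c *\<^sub>R x) \<le> c * (p (x + t *\<^sub>R y) - t * p y)" if "t \<ge> 0" for t
  proof -
    have "tilt p y (c *\<^sub>R x) \<le> p (c *\<^sub>R x + (c * t) *\<^sub>R y) - (c * t) * p y"
      using \<open>c \<ge> 0\<close> that by (intro tilt_le p) simp
    also have "c *\<^sub>R x + (c * t) *\<^sub>R y = c *\<^sub>R (x + t *\<^sub>R y)"
      by (simp add: algebra_simps)
    finally show ?thesis
      by (simp only: sublinear_scale[OF p \<open>c \<ge> 0\<close>] right_diff_distrib mult.assoc)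
  qed
  show "tilt p y (c *\<^sub>R x) \<le> c * tilt p y x"
  proof (cases "c = 0")
    case True
    then show ?thesis using *[of 0] by simp
  next
    case False
    then have "c > 0" using \<open>c \<ge> 0\<close> by simp
    have "tilt p y (c *\<^sub>R x) / c \<le> tilt p y x"
      by (rule le_tiltI) (use * \<open>c > 0\<close> in \<open>simp add: field_simps\<close>)
    then show ?thesis using \<open>c > 0\<close> by (simp add: field_simps)
  qed
qed

lemma tilt_le_self: "sublinear p \<Longrightarrow> tilt p y x \<le> p x"
  using tilt_le[of p 0 y x] by simp

lemma tilt_uminus: "sublinear p \<Longrightarrow> tilt p y (- y) \<le> - p y"
  using tilt_le[of p 1 y "- y"] by (simp add: sublinear_zero)

text \<open>Tilting a minimal \<open>p\<close> towards \<open>y\<close> cannot make it smaller, so \<open>p\<close> already satisfies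
  \<open>p (- y) \<le> - p y\<close>. An odd sublinear functional is linear.\<close>

lemma minimal_sublinear_is_linear:
  assumes p: "sublinear p"
    and minimal: "\<And>q. sublinear q \<Longrightarrow> q \<le> p \<Longrightarrow> q = p"
  shows "linear p"
proof -
  have odd: "p (- y) = - p y" for y
  proof -
    have "tilt p y = p"
      by (rule minimal) (auto simp: le_fun_def intro: sublinear_tilt tilt_le_self p)
    then have "p (- y) \<le> - p y"
      using tilt_uminus[OF p, of y] by simp
    then show ?thesis using sublinear_uminus[OF p, of y] by simp
  qed
  show ?thesis
  proof (rule linearI)
    fix x y
    have "p (- x + - y) \<le> p (- x) + p (- y)"
      by (rule sublinear_add[OF p])
    moreover have "p (- x + - y) = - p (x + y)"
      using odd[of "x + y"] by simp
    ultimately show "p (x + y) = p x + p y"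
      using sublinear_add[OF p, of x y] by (simp add: odd)
  next
    fix c x
    show "p (c *\<^sub>R x) = c *\<^sub>R p x"
    proof (cases "c \<ge> 0")
      case False
      then have "p ((- c) *\<^sub>R x) = (- c) * p x"
        by (intro sublinear_scale p) simp
      then show ?thesis by (simp add: odd)
    qed (simp add: sublinear_scale p)
  qed
qed

text \<open>By Zorn's lemma: the pointwise infimum of a nonempty chain is finite, since
  \<open>p x \<ge> - p (- x) \<ge> - q (- x)\<close> for all \<open>p\<close> below \<open>q\<close>, and it is sublinear, since any
  two members of the chain have a smaller one in common.\<close>

lemma exists_minimal_sublinear:
  assumes q: "sublinear q"
  shows "\<exists>p. sublinear p \<and> p \<le> q \<and> (\<forall>p'. sublinear p' \<longrightarrow> p' \<le> p \<longrightarrow> p' = p)"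
proof -
  define S where "S = {p. sublinear p \<and> p \<le> q}"
  have "\<exists>m\<in>S. \<forall>a\<in>S. a \<le> m \<longrightarrow> a = m"
  proof (rule predicate_Zorn)
    show "partial_order_on S (relation_of (\<lambda>a b. b \<le> a) S)"
      by (rule partial_order_on_relation_ofI) auto
  next
    fix C assume "C \<in> Chains (relation_of (\<lambda>a b. b \<le> a) S)"
    then have chain: "a \<in> S" "b \<in> S" "a \<le> b \<or> b \<le> a" if "a \<in> C" "b \<in> C" for a b
      using that unfolding Chains_def relation_of_def by blast+
    show "\<exists>u\<in>S. \<forall>a\<in>C. u \<le> a"
    proof (cases "C = {}")
      case True
      then show ?thesis using q by (auto simp: S_def)
    next
      case False
      define u where "u x = (INF p\<in>C. p x)" for x
      have lower: "u x \<le> p x" if "p \<in> C" for p x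
        unfolding u_def
      proof (rule cINF_lower[OF _ that])
        have "- q (- x) \<le> p' x" if "p' \<in> C" for p'
        proof -
          have "sublinear p'" "p' (- x) \<le> q (- x)"
            using chain(1)[OF that that] by (auto simp: S_def le_fun_def)
          then show ?thesis using sublinear_uminus[of p' x] by linarith
        qed
        then show "bdd_below ((\<lambda>p. p x) ` C)" by (rule bdd_belowI2)
      qed
      have greatest: "a \<le> u x" if "\<And>p. p \<in> C \<Longrightarrow> a \<le> p x" for a x
        unfolding u_def using False that by (rule cINF_greatest)
      have "sublinear u"
        unfolding sublinear_def
      proof (intro conjI allI impI)
        fix x y
        have *: "u (x + y) \<le> p x + p' y" if pC: "p \<in> C" "p' \<in> C" for p p'
        proof -
          obtain r where r: "r \<in> C" "r \<le> p" "r \<le> p'"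
            using chain(3)[OF pC] pC by blast
          have "u (x + y) \<le> r x + r y"
            using lower[OF r(1), of "x + y"] sublinear_add[of r x y] chain(1)[OF r(1) r(1)]
            by (simp add: S_def)
          also have "\<dots> \<le> p x + p' y"
            using r(2,3) by (intro add_mono) (auto simp: le_fun_def)
          finally show ?thesis .
        qed
        have "u (x + y) - u y \<le> u x"
        proof (rule greatest)
          fix p assume "p \<in> C"
          have "u (x + y) - p x \<le> u y"
            by (rule greatest) (use *[OF \<open>p \<in> C\<close>] in \<open>simp add: algebra_simps\<close>)
          then show "u (x + y) - u y \<le> p x" by simp
        qed
        then show "u (x + y) \<le> u x + u y" by simp
      next
        fix c :: real and x assume "c \<ge> 0"
        have *: "u (c *\<^sub>R x) \<le> c * p x" if "p \<in> C" for p
          using lower[OF that, of "c *\<^sub>R x"] chain(1)[OF that that] \<open>c \<ge> 0\<close>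
          by (simp add: S_def sublinear_scale)
        show "u (c *\<^sub>R x) \<le> c * u x"
        proof (cases "c = 0")
          case True
          then show ?thesis using * False by force
        next
          case False
          then have "c > 0" using \<open>c \<ge> 0\<close> by simp
          have "u (c *\<^sub>R x) / c \<le> u x"
            by (rule greatest) (use * \<open>c > 0\<close> in \<open>simp add: field_simps\<close>)
          then show ?thesis using \<open>c > 0\<close> by (simp add: field_simps)
        qed
      qed
      moreover have "u \<le> q"
      proof -
        obtain p where p: "p \<in> C" using False by blast
        then have "u \<le> p" using lower by (simp add: le_fun_def)
        then show ?thesis using chain(1)[OF p p] by (auto simp: S_def intro: order_trans)
      qed
      ultimately show ?thesis using lower by (auto simp: S_def le_fun_def)
    qed
  qed
  then obtain m where m: "m \<in> S" and minimal: "\<And>a. a \<in> S \<Longrightarrow> a \<le> m \<Longrightarrow> a = m"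
    by blast
  have "p' = m" if "sublinear p'" "p' \<le> m" for p'
    by (rule minimal) (use m that in \<open>auto simp: S_def intro: order_trans\<close>)
  then show ?thesis using m by (auto simp: S_def)
qed

text \<open>A minimal sublinear functional below \<open>tilt norm x\<close> is linear, is bounded by the norm, and has
  a value at most \<open>- norm x\<close> at \<open>- x\<close>.\<close>

lemma norming_functional:
  fixes x :: "'a::real_normed_vector"
  shows "\<exists>\<psi> :: 'a \<Rightarrow>\<^sub>L real. norm \<psi> \<le> 1 \<and> blinfun_apply \<psi> x = norm x"
proof -
  have norm: "sublinear (norm :: 'a \<Rightarrow> real)"
    unfolding sublinear_def by (auto simp: norm_triangle_ineq)
  obtain p where p: "sublinear p" "p \<le> tilt norm x"
    and "\<And>p'. sublinear p' \<Longrightarrow> p' \<le> p \<Longrightarrow> p' = p"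
    using exists_minimal_sublinear[OF sublinear_tilt[OF norm, of x]] by blast
  then have "linear p" by (intro minimal_sublinear_is_linear)
  have le: "p y \<le> norm y" for y
    using p(2) tilt_le_self[OF norm] unfolding le_fun_def by (meson order_trans)
  have abs_le: "norm (p y) \<le> norm y * 1" for y
    using le[of y] le[of "- y"] linear_neg[OF \<open>linear p\<close>, of y] by simp
  then have bl: "bounded_linear p"
    using \<open>linear p\<close> by (intro bounded_linear.intro bounded_linear_axioms.intro) blast+
  have "p (- x) \<le> - norm x"
    using p(2) tilt_uminus[OF norm, of x] unfolding le_fun_def by (meson order_trans)
  then have "p x = norm x"
    using le[of x] linear_neg[OF \<open>linear p\<close>, of x] by simp
  moreover have "norm (Blinfun p) \<le> 1"
    using abs_le by (intro norm_blinfun_bound) (simp_all add: bounded_linear_Blinfun_apply[OF bl])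
  ultimately show ?thesis
    by (intro exI[of _ "Blinfun p"]) (simp add: bounded_linear_Blinfun_apply[OF bl])
qed

section \<open>The dual of an infinite-dimensional space is infinite-dimensional\<close>

text \<open>Each functional cuts the dimension by at most one: modulo the multiples of a vector \<open>v\<close> with
  \<open>f v \<noteq> 0\<close>, every vector of \<open>V\<close> lies in the kernel of \<open>f\<close>.\<close>

lemma finite_span_if_separated_by_finitely_many_functionals:
  fixes V :: "'a::real_vector set" and F :: "('a \<Rightarrow> real) set"
  assumes "finite F" "\<And>f. f \<in> F \<Longrightarrow> linear f" "subspace V"
    and "\<And>x. x \<in> V \<Longrightarrow> (\<And>f. f \<in> F \<Longrightarrow> f x = 0) \<Longrightarrow> x = 0"
  shows "\<exists>B. finite B \<and> V \<subseteq> span B"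
  using assms
proof (induction F arbitrary: V rule: finite_induct)
  case empty
  have "x = 0" if "x \<in> V" for x
    by (rule empty.prems(3)[OF that]) simp
  then have "V \<subseteq> {0}" by blast
  then show ?case by (intro exI[of _ "{}"]) simp
next
  case (insert f F)
  have f: "linear f" by (rule insert.prems(1)) simp
  have "\<exists>B. finite B \<and> V \<inter> {x. f x = 0} \<subseteq> span B"
  proof (rule insert.IH)
    show "linear g" if "g \<in> F" for g
      by (rule insert.prems(1)) (use that in simp)
    show "subspace (V \<inter> {x. f x = 0})"
      using insert.prems(2) linear_subspace_kernel[OF f] by (rule subspace_inter)
    show "x = 0" if x: "x \<in> V \<inter> {x. f x = 0}" and "\<And>g. g \<in> F \<Longrightarrow> g x = 0" for x
    proof (rule insert.prems(3))
      show "x \<in> V" using x by simp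
      show "g x = 0" if "g \<in> insert f F" for g
        using that x \<open>\<And>g. g \<in> F \<Longrightarrow> g x = 0\<close> by (cases "g = f") simp_all
    qed
  qed
  then obtain B where B: "finite B" "V \<inter> {x. f x = 0} \<subseteq> span B"
    by blast
  show ?case
  proof (cases "V \<subseteq> {x. f x = 0}")
    case True
    then show ?thesis using B by blast
  next
    case False
    then obtain v where v: "v \<in> V" "f v \<noteq> 0" by blast
    have "x \<in> span (insert v B)" if "x \<in> V" for x
    proof -
      have "x - (f x / f v) *\<^sub>R v \<in> V \<inter> {x. f x = 0}"
        using v(2) subspace_diff[OF insert.prems(2) that subspace_scale[OF insert.prems(2) v(1)]]
        by (simp add: linear_diff[OF f] linear_scale[OF f])
      then have "x - (f x / f v) *\<^sub>R v \<in> span B" by (rule subsetD[OF B(2)])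
      then show ?thesis unfolding span_insert by blast
    qed
    then show ?thesis using B(1) by (intro exI[of _ "insert v B"]) auto
  qed
qed

text \<open>If finitely many functionals spanned the dual, then a common zero of them would be a zero of
  all functionals and hence vanish, by the existence of norming functionals. So they would separate
  points.\<close>

lemma infinite_dimensional_dual:
  assumes "infinite_dimensional TYPE('a::real_normed_vector)"
  shows "infinite_dimensional TYPE('a \<Rightarrow>\<^sub>L real)"
  unfolding infinite_dimensional_def
proof
  assume "\<exists>B :: ('a \<Rightarrow>\<^sub>L real) set. finite B \<and> span B = UNIV"
  then obtain F :: "('a \<Rightarrow>\<^sub>L real) set" where F: "finite F" "span F = UNIV" by blast
  have "\<exists>B. finite B \<and> (UNIV :: 'a set) \<subseteq> span B"
  proof (rule finite_span_if_separated_by_finitely_many_functionals[of "blinfun_apply ` F"])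
    show "finite (blinfun_apply ` F)" using F(1) by simp
    show "linear f" if "f \<in> blinfun_apply ` F" for f
      using that bounded_linear.linear[OF blinfun.bounded_linear_right] by blast
    show "x = 0" if 0: "\<And>f. f \<in> blinfun_apply ` F \<Longrightarrow> f x = 0" for x :: 'a
    proof -
      have "blinfun_apply \<psi> x = 0" for \<psi> :: "'a \<Rightarrow>\<^sub>L real"
      proof -
        have "\<psi> \<in> span F" using F by simp
        then show ?thesis
          by (induction rule: span_induct_alt) (auto simp: 0 blinfun.add_left blinfun.scaleR_left)
      qed
      then show ?thesis using norming_functional[of x] by auto
    qed
  qed simp
  then show False
    using assms unfolding infinite_dimensional_def by (auto simp: top.extremum_unique)
qed

section \<open>The diameter of convex combinations of slices\<close>

lemma blinfun_exceeds_below_norm: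
  fixes g :: "'a::real_normed_vector \<Rightarrow>\<^sub>L real"
  assumes "d < norm g"
  shows "\<exists>x. norm x \<le> 1 \<and> d < blinfun_apply g x"
proof (rule ccontr)
  assume "\<not> ?thesis"
  then have le: "blinfun_apply g x \<le> d" if "norm x \<le> 1" for x
    using that by (meson not_less)
  have "norm g \<le> d"
  proof (rule norm_blinfun_bound)
    show "0 \<le> d" using le[of 0] by simp
    fix x
    show "norm (blinfun_apply g x) \<le> d * norm x"
    proof (cases "x = 0")
      case False
      have "blinfun_apply g (inverse (norm x) *\<^sub>R x) \<le> d"
        "blinfun_apply g (- inverse (norm x) *\<^sub>R x) \<le> d"
        using False by (auto intro!: le)
      then show ?thesis
        using False by (simp add: blinfun.scaleR_right blinfun.minus_right field_simps abs_le_iff)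
    qed simp
  qed
  then show False using assms by simp
qed

lemma convex_combination_of_slices_bounded:
  assumes "\<And>i. i < n \<Longrightarrow> c i \<ge> 0" "(\<Sum>i<n. c i) = 1"
  shows "convex_combination_of_slices n c \<phi> \<epsilon> \<subseteq> cball 0 1"
proof
  fix y assume "y \<in> convex_combination_of_slices n c \<phi> \<epsilon>"
  then obtain z where z: "y = (\<Sum>i<n. c i *\<^sub>R z i)" "\<And>i. i < n \<Longrightarrow> norm (z i) \<le> 1"
    unfolding convex_combination_of_slices_def slice_def by auto
  have "norm y \<le> (\<Sum>i<n. norm (c i *\<^sub>R z i))"
    unfolding z(1) by (rule norm_sum)
  also have "\<dots> \<le> (\<Sum>i<n. c i)"
    using assms(1) z(2) by (intro sum_mono) (simp add: mult_left_le)
  finally show "y \<in> cball 0 1" using assms(2) by simp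
qed

text \<open>The upper bound on the diameter is automatic, because the combinations lie in the unit ball. It
  remains to find points whose distance is nearly 2.\<close>

lemma strong_diameter_2_propertyI:
  assumes "\<And>n c (\<phi> :: nat \<Rightarrow> 'z::real_normed_vector \<Rightarrow>\<^sub>L real) \<epsilon> (\<delta> :: real).
     \<lbrakk>\<And>i. i < n \<Longrightarrow> c i \<ge> 0; \<And>i. i < n \<Longrightarrow> norm (\<phi> i) = 1; \<And>i. i < n \<Longrightarrow> \<epsilon> i > 0;
       (\<Sum>i<n. c i) = 1; \<delta> > 0\<rbrakk> \<Longrightarrow>
     \<exists>z w. (\<forall>i<n. z i \<in> slice (\<phi> i) (\<epsilon> i) \<and> w i \<in> slice (\<phi> i) (\<epsilon> i)) \<and>
       norm ((\<Sum>i<n. c i *\<^sub>R z i) - (\<Sum>i<n. c i *\<^sub>R w i)) \<ge> 2 - \<delta>"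
  shows "strong_diameter_2_property TYPE('z)"
  unfolding strong_diameter_2_property_def
proof (intro allI impI)
  fix n and c :: "nat \<Rightarrow> real" and \<phi> :: "nat \<Rightarrow> 'z \<Rightarrow>\<^sub>L real" and \<epsilon> :: "nat \<Rightarrow> real"
  assume a: "(\<forall>i<n. 0 \<le> c i \<and> norm (\<phi> i) = 1 \<and> 0 < \<epsilon> i) \<and> sum c {..<n} = 1"
  let ?S = "convex_combination_of_slices n c \<phi> \<epsilon>"
  have S: "?S \<subseteq> cball 0 1"
    using a by (intro convex_combination_of_slices_bounded) auto
  then have bounded: "bounded ?S" using bounded_cball bounded_subset by blast
  show "diameter ?S = 2"
  proof (rule antisym)
    show "diameter ?S \<le> 2"
    proof (rule diameter_le)
      fix x y assume "x \<in> ?S" "y \<in> ?S"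
      then have "norm x \<le> 1" "norm y \<le> 1" using S by auto
      then show "norm (x - y) \<le> 2" using norm_triangle_ineq4[of x y] by simp
    qed simp
    show "2 \<le> diameter ?S"
    proof (rule field_le_epsilon)
      fix \<delta> :: real assume "\<delta> > 0"
      then obtain z w where zw: "\<forall>i<n. z i \<in> slice (\<phi> i) (\<epsilon> i) \<and> w i \<in> slice (\<phi> i) (\<epsilon> i)"
        and far: "norm ((\<Sum>i<n. c i *\<^sub>R z i) - (\<Sum>i<n. c i *\<^sub>R w i)) \<ge> 2 - \<delta>"
        using assms[of n c \<phi> \<epsilon> \<delta>] a by blast
      have "(\<Sum>i<n. c i *\<^sub>R z i) \<in> ?S" "(\<Sum>i<n. c i *\<^sub>R w i) \<in> ?S"
        using zw unfolding convex_combination_of_slices_def by blast+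
      then show "2 \<le> diameter ?S + \<delta>"
        using diameter_bounded_bound[OF bounded] far by (fastforce simp: dist_norm)
    qed
  qed
qed

lemma strong_diameter_2_propertyE:
  fixes \<phi> :: "nat \<Rightarrow> 'z::real_normed_vector \<Rightarrow>\<^sub>L real"
  assumes "strong_diameter_2_property TYPE('z)"
    and "\<And>i. i < n \<Longrightarrow> c i \<ge> 0" "\<And>i. i < n \<Longrightarrow> norm (\<phi> i) = 1" "\<And>i. i < n \<Longrightarrow> \<epsilon> i > 0"
    and "(\<Sum>i<n. c i) = 1" "d < 2"
  obtains z w where "\<And>i. i < n \<Longrightarrow> z i \<in> slice (\<phi> i) (\<epsilon> i)"
    "\<And>i. i < n \<Longrightarrow> w i \<in> slice (\<phi> i) (\<epsilon> i)"
    "d < norm ((\<Sum>i<n. c i *\<^sub>R z i) - (\<Sum>i<n. c i *\<^sub>R w i))"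
proof -
  let ?S = "convex_combination_of_slices n c \<phi> \<epsilon>"
  have "diameter ?S = 2"
    using assms unfolding strong_diameter_2_property_def by blast
  (* The maximum with 1 makes the bound positive, since d may be negative. *)
  then have "max d 1 < diameter ?S" using assms(6) by simp
  moreover have "bounded ?S"
    by (rule bounded_subset[OF bounded_cball convex_combination_of_slices_bounded[OF assms(2,5)]])
  ultimately have "\<exists>x\<in>?S. \<exists>y\<in>?S. max d 1 < dist x y"
    by (intro diameter_lower_bounded) simp_all
  then show ?thesis
    using that unfolding convex_combination_of_slices_def dist_norm by fastforce
qed

section \<open>From the bidual to the space\<close>

text \<open>The values of \<open>\<phi>\<close> and \<open>f\<close> on the unit ball form a convex subset of the plane. If the pair of
  values of \<open>z\<close> were outside its closure, then a separating line would give a combination \<open>g\<close> of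
  \<open>\<phi>\<close> and \<open>f\<close> with \<open>\<bar>z g\<bar> > norm g\<close>.\<close>

lemma bidual_ball_approximation:
  fixes z :: "('a::real_normed_vector \<Rightarrow>\<^sub>L real) \<Rightarrow>\<^sub>L real" and \<phi> f :: "'a \<Rightarrow>\<^sub>L real"
  assumes z: "norm z \<le> 1" and "\<delta> > 0"
  shows "\<exists>x. norm x \<le> 1 \<and> \<bar>blinfun_apply \<phi> x - blinfun_apply z \<phi>\<bar> < \<delta> \<and>
    \<bar>blinfun_apply f x - blinfun_apply z f\<bar> < \<delta>"
proof -
  define J where "J x = (blinfun_apply \<phi> x, blinfun_apply f x)" for x
  have "linear J"
    unfolding J_def by (intro linearI) (auto simp: blinfun.add_right blinfun.scaleR_right)
  then have "convex (J ` cball 0 1)"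
    by (intro convex_linear_image convex_cball)
  have "(blinfun_apply z \<phi>, blinfun_apply z f) \<in> closure (J ` cball 0 1)"
  proof (rule ccontr)
    assume "(blinfun_apply z \<phi>, blinfun_apply z f) \<notin> closure (J ` cball 0 1)"
    from separating_hyperplane_closed_point
      [OF convex_closure[OF \<open>convex (J ` cball 0 1)\<close>] closed_closure this]
    obtain a b where a: "a \<bullet> (blinfun_apply z \<phi>, blinfun_apply z f) < b"
      and b: "\<And>y. y \<in> closure (J ` cball 0 1) \<Longrightarrow> b < a \<bullet> y"
      by blast
    define g where "g = fst a *\<^sub>R \<phi> + snd a *\<^sub>R f"
    have "blinfun_apply z g = a \<bullet> (blinfun_apply z \<phi>, blinfun_apply z f)"
      by (simp add: g_def inner_prod_def blinfun.add_right blinfun.scaleR_right)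
    then have "blinfun_apply z g < b" using a by simp
    moreover have "\<bar>blinfun_apply z g\<bar> \<le> norm z * norm g"
      using norm_blinfun[of z g] by simp
    moreover have "norm z * norm g \<le> norm g"
      using z by (simp add: mult_left_le_one_le)
    ultimately have "- b < norm g" by linarith
    then obtain x where x: "norm x \<le> 1" "- b < blinfun_apply g x"
      using blinfun_exceeds_below_norm by blast
    have "J (- x) \<in> closure (J ` cball 0 1)"
      using x(1) closure_subset[of "J ` cball 0 1"] by fastforce
    then have "b < a \<bullet> J (- x)" by (rule b)
    also have "a \<bullet> J (- x) = - blinfun_apply g x"
      by (simp add: J_def g_def inner_prod_def blinfun.add_left blinfun.scaleR_left blinfun.minus_right)
    finally show False using x(2) by simp
  qed
  then obtain x where x: "norm x \<le> 1" "dist (J x) (blinfun_apply z \<phi>, blinfun_apply z f) < \<delta>"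
    using \<open>\<delta> > 0\<close> unfolding closure_approachable by auto
  have "\<bar>blinfun_apply \<phi> x - blinfun_apply z \<phi>\<bar> < \<delta>"
    using dist_fst_le[of "J x" "(blinfun_apply z \<phi>, blinfun_apply z f)"] x(2)
    by (simp add: J_def dist_real_def)
  moreover have "\<bar>blinfun_apply f x - blinfun_apply z f\<bar> < \<delta>"
    using dist_snd_le[of "J x" "(blinfun_apply z \<phi>, blinfun_apply z f)"] x(2)
    by (simp add: J_def dist_real_def)
  ultimately show ?thesis using x(1) by blast
qed

text \<open>The canonical embedding into the bidual.\<close>

definition evaluation :: "'a::real_normed_vector \<Rightarrow> ('a \<Rightarrow>\<^sub>L real) \<Rightarrow>\<^sub>L real" where
  "evaluation x = Blinfun (\<lambda>f. blinfun_apply f x)"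

lemma evaluation_apply [simp]: "blinfun_apply (evaluation x) f = blinfun_apply f x"
  unfolding evaluation_def
  by (simp add: bounded_linear_Blinfun_apply blinfun.bounded_linear_left)

lemma norm_evaluation_le: "norm (evaluation x) \<le> norm x"
proof (rule norm_blinfun_bound)
  show "norm (blinfun_apply (evaluation x) f) \<le> norm x * norm f" for f
    using norm_blinfun[of f x] by (simp add: mult.commute)
qed simp

text \<open>For a functional, the norm of the embedding is seen by testing on the embedded vectors.\<close>

lemma norm_evaluation_functional:
  fixes \<phi> :: "'a::real_normed_vector \<Rightarrow>\<^sub>L real"
  shows "norm (evaluation \<phi>) = norm \<phi>"
proof (rule antisym[OF norm_evaluation_le])
  show "norm \<phi> \<le> norm (evaluation \<phi>)"
  proof (rule norm_blinfun_bound)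
    fix x
    have "norm (blinfun_apply \<phi> x) = norm (blinfun_apply (evaluation \<phi>) (evaluation x))" by simp
    also have "\<dots> \<le> norm (evaluation \<phi>) * norm (evaluation x)" by (rule norm_blinfun)
    also have "\<dots> \<le> norm (evaluation \<phi>) * norm x"
      by (intro mult_left_mono norm_evaluation_le) simp
    finally show "norm (blinfun_apply \<phi> x) \<le> norm (evaluation \<phi>) * norm x" .
  qed simp
qed

lemma approximation_in_slice:
  assumes "z \<in> slice (evaluation \<phi>) \<epsilon>" "\<delta> > 0"
  shows "\<exists>x \<in> slice \<phi> \<epsilon>. \<bar>blinfun_apply f x - blinfun_apply z f\<bar> < \<delta>"
proof -
  have z: "norm z \<le> 1" "blinfun_apply z \<phi> > 1 - \<epsilon>"
    using assms(1) by (auto simp: slice_def)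
  then obtain x where x: "norm x \<le> 1"
    and "\<bar>blinfun_apply \<phi> x - blinfun_apply z \<phi>\<bar> < min \<delta> (blinfun_apply z \<phi> - (1 - \<epsilon>))"
    and "\<bar>blinfun_apply f x - blinfun_apply z f\<bar> < min \<delta> (blinfun_apply z \<phi> - (1 - \<epsilon>))"
    using bidual_ball_approximation[OF z(1), of "min \<delta> (blinfun_apply z \<phi> - (1 - \<epsilon>))" \<phi> f] assms(2)
    by auto
  then show ?thesis by (intro bexI[of _ x]) (auto simp: slice_def)
qed

lemma strong_diameter_2_property_from_bidual:
  assumes sd2p: "strong_diameter_2_property TYPE(('a::real_normed_vector \<Rightarrow>\<^sub>L real) \<Rightarrow>\<^sub>L real)"
  shows "strong_diameter_2_property TYPE('a)"
proof (rule strong_diameter_2_propertyI)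
  fix n and c :: "nat \<Rightarrow> real" and \<phi> :: "nat \<Rightarrow> 'a \<Rightarrow>\<^sub>L real" and \<epsilon> :: "nat \<Rightarrow> real" and \<delta> :: real
  assume c: "\<And>i. i < n \<Longrightarrow> c i \<ge> 0" "(\<Sum>i<n. c i) = 1" and \<phi>: "\<And>i. i < n \<Longrightarrow> norm (\<phi> i) = 1"
    and \<epsilon>: "\<And>i. i < n \<Longrightarrow> \<epsilon> i > 0" and "\<delta> > 0"
  (* One third is lost to the choice of f, and one to each of the two families of approximations. *)
  define \<eta> where "\<eta> = \<delta> / 3"
  have "\<eta> > 0" using \<open>\<delta> > 0\<close> by (simp add: \<eta>_def)
  obtain Z W where Z: "\<And>i. i < n \<Longrightarrow> Z i \<in> slice (evaluation (\<phi> i)) (\<epsilon> i)"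
    and W: "\<And>i. i < n \<Longrightarrow> W i \<in> slice (evaluation (\<phi> i)) (\<epsilon> i)"
    and "2 - \<eta> < norm ((\<Sum>i<n. c i *\<^sub>R Z i) - (\<Sum>i<n. c i *\<^sub>R W i))"
    using strong_diameter_2_propertyE[OF sd2p, of n c "\<lambda>i. evaluation (\<phi> i)" \<epsilon> "2 - \<eta>"]
      c \<phi> \<epsilon> \<open>\<eta> > 0\<close> by (auto simp: norm_evaluation_functional)
  then obtain f where f: "norm f \<le> 1"
    and far: "2 - \<eta> < blinfun_apply ((\<Sum>i<n. c i *\<^sub>R Z i) - (\<Sum>i<n. c i *\<^sub>R W i)) f"
    using blinfun_exceeds_below_norm by blast
  have "\<exists>x. i < n \<longrightarrow> x \<in> slice (\<phi> i) (\<epsilon> i) \<and> \<bar>blinfun_apply f x - blinfun_apply (Z i) f\<bar> < \<eta>" for i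
    using approximation_in_slice[OF Z \<open>\<eta> > 0\<close>] by blast
  then obtain z where z: "\<And>i. i < n \<Longrightarrow> z i \<in> slice (\<phi> i) (\<epsilon> i)"
    and zZ: "\<And>i. i < n \<Longrightarrow> \<bar>blinfun_apply f (z i) - blinfun_apply (Z i) f\<bar> < \<eta>" by metis
  have "\<exists>x. i < n \<longrightarrow> x \<in> slice (\<phi> i) (\<epsilon> i) \<and> \<bar>blinfun_apply f x - blinfun_apply (W i) f\<bar> < \<eta>" for i
    using approximation_in_slice[OF W \<open>\<eta> > 0\<close>] by blast
  then obtain w where w: "\<And>i. i < n \<Longrightarrow> w i \<in> slice (\<phi> i) (\<epsilon> i)"
    and wW: "\<And>i. i < n \<Longrightarrow> \<bar>blinfun_apply f (w i) - blinfun_apply (W i) f\<bar> < \<eta>" by metis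
  let ?d = "(\<Sum>i<n. c i *\<^sub>R z i) - (\<Sum>i<n. c i *\<^sub>R w i)"
  have "(\<Sum>i<n. c i * blinfun_apply (Z i) f) - (\<Sum>i<n. c i * blinfun_apply (W i) f) - 2 * \<eta>
      = (\<Sum>i<n. c i * (blinfun_apply (Z i) f - blinfun_apply (W i) f - 2 * \<eta>))"
    using c(2) by (simp add: algebra_simps sum_subtractf sum.distrib flip: sum_distrib_left sum_distrib_right)
  also have "\<dots> \<le> (\<Sum>i<n. c i * (blinfun_apply f (z i) - blinfun_apply f (w i)))"
    using c(1) zZ wW by (intro sum_mono mult_left_mono) (fastforce simp: abs_less_iff)+
  also have "\<dots> = blinfun_apply f ?d"
    by (simp add: blinfun.diff_right blinfun.sum_right blinfun.scaleR_right right_diff_distrib sum_subtractf)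
  finally have "2 - \<delta> \<le> blinfun_apply f ?d"
    using far by (simp add: \<eta>_def blinfun.diff_left blinfun.sum_left blinfun.scaleR_left)
  also have "\<dots> \<le> norm f * norm ?d"
    using norm_blinfun[of f ?d] by simp
  also have "\<dots> \<le> norm ?d"
    using f by (simp add: mult_left_le_one_le)
  finally show "\<exists>z w. (\<forall>i<n. z i \<in> slice (\<phi> i) (\<epsilon> i) \<and> w i \<in> slice (\<phi> i) (\<epsilon> i)) \<and>
       norm ((\<Sum>i<n. c i *\<^sub>R z i) - (\<Sum>i<n. c i *\<^sub>R w i)) \<ge> 2 - \<delta>"
    using z w by blast
qed

section \<open>Duals of spaces with infinitely many disjoint L-projections\<close>

text \<open>A combination of the \<open>g k\<close> with coefficients in \<open>{-1, 0, 1}\<close> has norm at most 1, because the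
  sum of the norms of the \<open>p k u\<close> is at most \<open>norm u\<close>. Taking as coefficients the signs of
  \<open>\<phi> (g k)\<close> bounds \<open>\<Sum>k\<le>n. \<bar>\<phi> (g k)\<bar>\<close> by \<open>norm \<phi>\<close>, so the series converges.\<close>

lemma functional_tendsto_0_on_disjoint:
  fixes g :: "nat \<Rightarrow> 'e::real_normed_vector \<Rightarrow>\<^sub>L real" and p :: "nat \<Rightarrow> 'e \<Rightarrow> 'e"
    and \<phi> :: "('e \<Rightarrow>\<^sub>L real) \<Rightarrow>\<^sub>L real"
  assumes sum_le: "\<And>K u. finite K \<Longrightarrow> (\<Sum>k\<in>K. norm (p k u)) \<le> norm u"
    and g: "\<And>k u. \<bar>blinfun_apply (g k) u\<bar> \<le> norm (p k u)"
  shows "(\<lambda>k. blinfun_apply \<phi> (g k)) \<longlonglongrightarrow> 0"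
proof -
  have "summable (\<lambda>k. \<bar>blinfun_apply \<phi> (g k)\<bar>)"
  proof (rule bounded_imp_summable)
    fix n
    define h where "h = (\<Sum>k\<le>n. sgn (blinfun_apply \<phi> (g k)) *\<^sub>R g k)"
    have "norm h \<le> 1"
    proof (rule norm_blinfun_bound)
      fix u
      have "norm (blinfun_apply h u) \<le> (\<Sum>k\<le>n. norm (sgn (blinfun_apply \<phi> (g k)) *\<^sub>R blinfun_apply (g k) u))"
        unfolding h_def blinfun.sum_left blinfun.scaleR_left by (rule norm_sum)
      also have "\<dots> \<le> (\<Sum>k\<le>n. norm (p k u))"
        using g by (intro sum_mono) (auto simp: abs_mult sgn_real_def)
      also have "\<dots> \<le> norm u" by (rule sum_le) simp
      finally show "norm (blinfun_apply h u) \<le> 1 * norm u" by simp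
    qed simp
    have "(\<Sum>k\<le>n. \<bar>blinfun_apply \<phi> (g k)\<bar>) = blinfun_apply \<phi> h"
      by (simp add: h_def blinfun.sum_right blinfun.scaleR_right abs_sgn mult.commute)
    also have "\<dots> \<le> norm \<phi> * norm h"
      using norm_blinfun[of \<phi> h] by simp
    also have "\<dots> \<le> norm \<phi>"
      using \<open>norm h \<le> 1\<close> by (simp add: mult_left_le)
    finally show "(\<Sum>k\<le>n. \<bar>blinfun_apply \<phi> (g k)\<bar>) \<le> norm \<phi>" .
  qed simp
  then show ?thesis
    by (rule tendsto_rabs_zero_cancel[OF summable_LIMSEQ_zero])
qed

text \<open>For large \<open>k\<close> the points \<open>z i\<close> of the slices may be replaced by
  \<open>w s i = z i - z i \<circ> p k + s * (\<psi> \<circ> p k)\<close> with \<open>s = \<plusminus>1\<close>. All \<open>w s i\<close> have the same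
  value \<open>s\<close> at the same unit vector, which is why the distance survives convex combinations.\<close>

lemma strong_diameter_2_property_dual:
  fixes p :: "nat \<Rightarrow> 'e::real_normed_vector \<Rightarrow> 'e"
  assumes lin: "\<And>k. linear (p k)"
    and idem: "\<And>k u. p k (p k u) = p k u"
    and split: "\<And>k u. norm u = norm (p k u) + norm (u - p k u)"
    and sum_le: "\<And>K u. finite K \<Longrightarrow> (\<Sum>k\<in>K. norm (p k u)) \<le> norm u"
    and nonzero: "\<And>k. \<exists>u. p k u \<noteq> 0"
  shows "strong_diameter_2_property TYPE('e \<Rightarrow>\<^sub>L real)"
proof (rule strong_diameter_2_propertyI)
  fix n and c :: "nat \<Rightarrow> real" and \<phi> :: "nat \<Rightarrow> ('e \<Rightarrow>\<^sub>L real) \<Rightarrow>\<^sub>L real" and \<epsilon> :: "nat \<Rightarrow> real"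
    and \<delta> :: real
  assume c: "\<And>i. i < n \<Longrightarrow> c i \<ge> 0" "(\<Sum>i<n. c i) = 1" and \<phi>: "\<And>i. i < n \<Longrightarrow> norm (\<phi> i) = 1"
    and \<epsilon>: "\<And>i. i < n \<Longrightarrow> \<epsilon> i > 0" and "\<delta> > 0"
  have bl: "bounded_linear (p k)" for k
  proof (rule bounded_linear_intro[where K = 1])
    show "norm (p k x) \<le> norm x * 1" for x using split[of x k] by simp
  qed (simp_all add: linear_add[OF lin] linear_scale[OF lin])
  define P where "P k = Blinfun (p k)" for k
  have P: "blinfun_apply (P k) = p k" for k
    by (simp add: P_def bounded_linear_Blinfun_apply bl)
  have "\<exists>u \<psi>. norm u = 1 \<and> p k u = u \<and> norm \<psi> \<le> 1 \<and> blinfun_apply \<psi> u = (1::real)" for k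
  proof -
    obtain v where v: "p k v \<noteq> 0" using nonzero by blast
    define u where "u = inverse (norm (p k v)) *\<^sub>R p k v"
    have "norm u = 1" "p k u = u"
      using v by (simp_all add: u_def linear_scale[OF lin] idem)
    then show ?thesis using norming_functional[of u] by auto
  qed
  then obtain u \<psi> where u: "\<And>k. norm (u k) = 1" "\<And>k. p k (u k) = u k"
    and \<psi>: "\<And>k. norm (\<psi> k) \<le> 1" "\<And>k. blinfun_apply (\<psi> k) (u k) = (1::real)"
    by metis
  have contraction: "\<bar>blinfun_apply f x\<bar> \<le> norm x" if "norm f \<le> 1" for f :: "'e \<Rightarrow>\<^sub>L real" and x
    using norm_blinfun[of f x] mult_right_mono[OF that norm_ge_zero[of x]] by simp
  have "\<exists>z. i < n \<longrightarrow> norm z \<le> 1 \<and> 1 - \<epsilon> i < blinfun_apply (\<phi> i) z" for i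
    using blinfun_exceeds_below_norm[of "1 - \<epsilon> i" "\<phi> i"] \<phi>[of i] \<epsilon>[of i] by auto
  then obtain z where z: "\<And>i. i < n \<Longrightarrow> norm (z i) \<le> 1"
      "\<And>i. i < n \<Longrightarrow> 1 - \<epsilon> i < blinfun_apply (\<phi> i) (z i)"
    by metis
  define e where "e k = \<psi> k o\<^sub>L P k" for k
  (* The part of z i to be removed; like e k, it lives on the range of p k. *)
  define m where "m i k = z i o\<^sub>L P k" for i k
  have e_le: "\<bar>blinfun_apply (e k) x\<bar> \<le> norm (p k x)" for k x
    using contraction[OF \<psi>(1)] by (simp add: e_def P)
  have m_le: "\<bar>blinfun_apply (m i k) x\<bar> \<le> norm (p k x)" if "i < n" for i k x
    using contraction[OF z(1)[OF that]] by (simp add: m_def P)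
  have "\<forall>\<^sub>F k in sequentially. \<bar>blinfun_apply (\<phi> i) (m i k)\<bar> + \<bar>blinfun_apply (\<phi> i) (e k)\<bar>
      < blinfun_apply (\<phi> i) (z i) - (1 - \<epsilon> i)" if "i < n" for i
  proof -
    have "(\<lambda>k. blinfun_apply (\<phi> i) (m i k)) \<longlonglongrightarrow> 0" "(\<lambda>k. blinfun_apply (\<phi> i) (e k)) \<longlonglongrightarrow> 0"
      using functional_tendsto_0_on_disjoint[OF sum_le] e_le m_le[OF that] by blast+
    then have "(\<lambda>k. \<bar>blinfun_apply (\<phi> i) (m i k)\<bar> + \<bar>blinfun_apply (\<phi> i) (e k)\<bar>) \<longlonglongrightarrow> 0"
      by (intro tendsto_add_zero tendsto_rabs_zero)
    then show ?thesis using z(2)[OF that] by (intro order_tendstoD) auto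
  qed
  then have "\<forall>\<^sub>F k in sequentially. \<forall>i\<in>{..<n}. \<bar>blinfun_apply (\<phi> i) (m i k)\<bar> + \<bar>blinfun_apply (\<phi> i) (e k)\<bar>
      < blinfun_apply (\<phi> i) (z i) - (1 - \<epsilon> i)"
    by (intro eventually_ball_finite) auto
  then obtain k where k: "\<And>i. i < n \<Longrightarrow> \<bar>blinfun_apply (\<phi> i) (m i k)\<bar> + \<bar>blinfun_apply (\<phi> i) (e k)\<bar>
      < blinfun_apply (\<phi> i) (z i) - (1 - \<epsilon> i)"
    unfolding eventually_sequentially by blast
  define w where "w s i = z i - m i k + s *\<^sub>R e k" for s :: real and i
  have w_slice: "w s i \<in> slice (\<phi> i) (\<epsilon> i)" if "i < n" "\<bar>s\<bar> = 1" for s i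
  proof -
    have "norm (w s i) \<le> 1"
    proof (rule norm_blinfun_bound)
      fix x
      have "blinfun_apply (w s i) x = blinfun_apply (z i) (x - p k x) + s * blinfun_apply (e k) x"
        by (simp add: w_def m_def P blinfun.add_left blinfun.diff_left blinfun.scaleR_left blinfun.diff_right)
      also have "\<bar>\<dots>\<bar> \<le> \<bar>blinfun_apply (z i) (x - p k x)\<bar> + \<bar>s * blinfun_apply (e k) x\<bar>"
        by (rule abs_triangle_ineq)
      also have "\<dots> \<le> norm (x - p k x) + norm (p k x)"
        using contraction[OF z(1)[OF that(1)], of "x - p k x"] e_le[of k x] that(2)
        by (simp add: abs_mult)
      also have "\<dots> = norm x" using split[of x k] by simp
      finally show "norm (blinfun_apply (w s i) x) \<le> 1 * norm x" by simp
    qed simp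
    moreover have "1 - \<epsilon> i < blinfun_apply (\<phi> i) (w s i)"
    proof -
      have "\<bar>s * blinfun_apply (\<phi> i) (e k)\<bar> = \<bar>blinfun_apply (\<phi> i) (e k)\<bar>"
        using that(2) by (simp add: abs_mult)
      moreover have "blinfun_apply (\<phi> i) (w s i) =
          blinfun_apply (\<phi> i) (z i) - blinfun_apply (\<phi> i) (m i k) + s * blinfun_apply (\<phi> i) (e k)"
        by (simp add: w_def blinfun.add_right blinfun.diff_right blinfun.scaleR_right)
      ultimately show ?thesis using k[OF that(1)] by linarith
    qed
    ultimately show ?thesis by (simp add: slice_def)
  qed
  have "blinfun_apply (w s i) (u k) = s" for s i
    by (simp add: w_def m_def e_def P u \<psi> blinfun.add_left blinfun.diff_left blinfun.scaleR_left)
  then have "blinfun_apply ((\<Sum>i<n. c i *\<^sub>R w 1 i) - (\<Sum>i<n. c i *\<^sub>R w (- 1) i)) (u k) = 2"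
    using c(2) by (simp add: blinfun.diff_left blinfun.sum_left blinfun.scaleR_left sum_negf)
  then have "2 \<le> norm ((\<Sum>i<n. c i *\<^sub>R w 1 i) - (\<Sum>i<n. c i *\<^sub>R w (- 1) i))"
    using norm_blinfun[of "(\<Sum>i<n. c i *\<^sub>R w 1 i) - (\<Sum>i<n. c i *\<^sub>R w (- 1) i)" "u k"] u(1) by simp
  then show "\<exists>z w. (\<forall>i<n. z i \<in> slice (\<phi> i) (\<epsilon> i) \<and> w i \<in> slice (\<phi> i) (\<epsilon> i)) \<and>
       norm ((\<Sum>i<n. c i *\<^sub>R z i) - (\<Sum>i<n. c i *\<^sub>R w i)) \<ge> 2 - \<delta>"
    using w_slice \<open>\<delta> > 0\<close> by (intro exI[of _ "w 1"] exI[of _ "w (- 1)"]) auto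
qed

section \<open>Restriction to measurable sets in spaces isometric to an L1-space\<close>

text \<open>A choice of one integrable function \<open>r u\<close> in the class of each vector \<open>u\<close>. Injectivity of
  the class map is contained in \<open>norm_rep\<close>; see \<open>rep_eqI\<close> below.\<close>

locale L1_representation =
  fixes M :: "'b measure" and r :: "'z::real_normed_vector \<Rightarrow> 'b \<Rightarrow> real"
  assumes integrable_rep: "integrable M (r u)"
    and rep_add: "AE x in M. r (u + v) x = r u x + r v x"
    and rep_scale: "AE x in M. r (c *\<^sub>R u) x = c * r u x"
    and norm_rep: "norm u = (\<integral>x. \<bar>r u x\<bar> \<partial>M)"
    and rep_surj: "integrable M f \<Longrightarrow> \<exists>u. AE x in M. r u x = f x"

lemma isometric_to_L1_representation:
  assumes "isometric_to_L1 TYPE('z::real_normed_vector) (M :: 'b measure)"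
  shows "\<exists>r :: 'z \<Rightarrow> 'b \<Rightarrow> real. L1_representation M r"
proof -
  obtain T :: "'z \<Rightarrow> ('b \<Rightarrow> real) set" where bij: "bij_betw T UNIV (L1_space M)"
    and add: "\<And>u v f g. f \<in> T u \<Longrightarrow> g \<in> T v \<Longrightarrow> (\<lambda>x. f x + g x) \<in> T (u + v)"
    and scale: "\<And>c u f. f \<in> T u \<Longrightarrow> (\<lambda>x. c * f x) \<in> T (c *\<^sub>R u)"
    and norm: "\<And>u f. f \<in> T u \<Longrightarrow> norm u = (\<integral>x. \<bar>f x\<bar> \<partial>M)"
    using assms unfolding isometric_to_L1_def by (elim exE conjE) blast
  let ?R = "{(f, g). integrable M f \<and> integrable M g \<and> (AE x in M. f x = g x)}"
  have T_class: "\<exists>f. integrable M f \<and> T u = ?R `` {f}" for u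
  proof -
    have "T u \<in> {f. integrable M f} // ?R"
      using bij_betw_apply[OF bij UNIV_I] unfolding L1_space_def .
    then obtain f where "T u = ?R `` {f}" "f \<in> {f. integrable M f}" by (rule quotientE)
    then show ?thesis by (intro exI[of _ f] conjI) (simp_all only: mem_Collect_eq)
  qed
  have T_ne: "\<exists>f. f \<in> T u" for u
    using T_class[of u] by auto
  have T_int: "integrable M f" if "f \<in> T u" for f u
    using T_class[of u] that by auto
  have T_AE: "AE x in M. f x = g x" if "f \<in> T u" "g \<in> T u" for f g u
  proof -
    obtain h where "T u = ?R `` {h}" using T_class[of u] by blast
    then have "AE x in M. h x = f x" "AE x in M. h x = g x"
      using that by simp_all
    then show ?thesis by eventually_elim simp
  qed
  obtain r where r: "\<And>u. r u \<in> T u" using T_ne by metis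
  have "L1_representation M r"
  proof
    fix u v c and f :: "'b \<Rightarrow> real"
    show "integrable M (r u)" using T_int r by blast
    show "AE x in M. r (u + v) x = r u x + r v x" by (rule T_AE[OF r add[OF r r]])
    show "AE x in M. r (c *\<^sub>R u) x = c * r u x" by (rule T_AE[OF r scale[OF r]])
    show "norm u = (\<integral>x. \<bar>r u x\<bar> \<partial>M)" by (rule norm[OF r])
    assume f: "integrable M f"
    then have "?R `` {f} \<in> L1_space M" unfolding L1_space_def quotient_def by blast
    then have "?R `` {f} \<in> range T"
      by (simp only: bij_betw_imp_surj_on[OF bij])
    then obtain u where "?R `` {f} = T u" by (rule imageE)
    then have "f \<in> T u" using f by (simp flip: \<open>?R `` {f} = T u\<close>)
    then show "\<exists>u. AE x in M. r u x = f x" using T_AE[OF r] by blast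
  qed
  then show ?thesis by blast
qed

context L1_representation
begin

lemma rep_minus: "AE x in M. r (u - v) x = r u x - r v x"
  using rep_add[of u "(- 1) *\<^sub>R v"] rep_scale[of "- 1" v] by eventually_elim simp

lemma rep_eqI:
  assumes "AE x in M. r u x = r v x"
  shows "u = v"
proof -
  have "AE x in M. \<bar>r (u - v) x\<bar> = 0"
    using assms rep_minus[of u v] by eventually_elim simp
  then have "norm (u - v) = 0"
    unfolding norm_rep by (rule integral_eq_zero_AE)
  then show ?thesis by simp
qed

lemma integrable_indicator_rep: "A \<in> sets M \<Longrightarrow> integrable M (\<lambda>x. indicator A x * r u x)"
  using integrable_mult_indicator[OF _ integrable_rep, of A u] by simp

definition restriction :: "'b set \<Rightarrow> 'z \<Rightarrow> 'z" where
  "restriction A u = (SOME v. AE x in M. r v x = indicator A x * r u x)"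

lemma rep_restriction:
  assumes "A \<in> sets M"
  shows "AE x in M. r (restriction A u) x = indicator A x * r u x"
  unfolding restriction_def
  by (rule someI_ex) (rule rep_surj[OF integrable_indicator_rep[OF assms]])

lemma linear_restriction:
  assumes "A \<in> sets M"
  shows "linear (restriction A)"
proof (rule linearI)
  fix u v c
  show "restriction A (u + v) = restriction A u + restriction A v"
    using rep_restriction[OF assms, of "u + v"] rep_restriction[OF assms, of u]
      rep_restriction[OF assms, of v] rep_add[of u v] rep_add[of "restriction A u" "restriction A v"]
    by (intro rep_eqI, eventually_elim) (simp add: algebra_simps)
  show "restriction A (c *\<^sub>R u) = c *\<^sub>R restriction A u"
    using rep_restriction[OF assms, of "c *\<^sub>R u"] rep_restriction[OF assms, of u]
      rep_scale[of c u] rep_scale[of c "restriction A u"]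
    by (intro rep_eqI, eventually_elim) simp
qed

lemma restriction_idem:
  assumes "A \<in> sets M"
  shows "restriction A (restriction A u) = restriction A u"
  using rep_restriction[OF assms, of "restriction A u"] rep_restriction[OF assms, of u]
  by (intro rep_eqI, eventually_elim) (simp add: indicator_def)

lemma restriction_space: "restriction (space M) u = u"
  using rep_restriction[OF sets.top, of u] AE_space
  by (intro rep_eqI, eventually_elim) simp

lemma restriction_split:
  assumes "A \<in> sets M" "B \<in> sets M" "B \<subseteq> A"
  shows "restriction A u = restriction B u + restriction (A - B) u"
  using rep_restriction[OF assms(1), of u] rep_restriction[OF assms(2), of u]
    rep_restriction[OF sets.Diff[OF assms(1,2)], of u] rep_add[of "restriction B u" "restriction (A - B) u"]
  by (intro rep_eqI, eventually_elim) (use assms(3) in \<open>auto simp: indicator_def\<close>)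

lemma norm_restriction:
  assumes "A \<in> sets M"
  shows "norm (restriction A u) = (\<integral>x. indicator A x * \<bar>r u x\<bar> \<partial>M)"
  unfolding norm_rep
proof (rule integral_cong_AE)
  show "AE x in M. \<bar>r (restriction A u) x\<bar> = indicator A x * \<bar>r u x\<bar>"
    using rep_restriction[OF assms, of u] by eventually_elim (simp add: abs_mult)
qed (use integrable_rep assms in measurable)

lemma norm_restriction_split:
  assumes "A \<in> sets M"
  shows "norm u = norm (restriction A u) + norm (u - restriction A u)"
proof -
  have "u - restriction A u = restriction (space M - A) u"
    using restriction_split[OF sets.top assms sets.sets_into_space[OF assms], of u]
    by (metis add_diff_cancel_left' restriction_space)
  moreover have "integrable M (\<lambda>x. indicator B x * \<bar>r u x\<bar>)" if "B \<in> sets M" for B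
    using integrable_mult_indicator[OF that integrable_abs[OF integrable_rep, of u]] by simp
  ultimately have "norm (restriction A u) + norm (u - restriction A u) =
      (\<integral>x. indicator A x * \<bar>r u x\<bar> + indicator (space M - A) x * \<bar>r u x\<bar> \<partial>M)"
    using assms by (simp add: norm_restriction)
  also have "\<dots> = (\<integral>x. \<bar>r u x\<bar> \<partial>M)"
    by (intro Bochner_Integration.integral_cong) (auto simp: indicator_def)
  finally show ?thesis by (simp add: norm_rep)
qed

lemma sum_norm_restriction_le:
  assumes D: "\<And>k. D k \<in> sets M" "disjoint_family D" and "finite K"
  shows "(\<Sum>k\<in>K. norm (restriction (D k) u)) \<le> norm u"
proof -
  have int: "integrable M (\<lambda>x. \<bar>r u x\<bar>)" using integrable_rep by simp
  then have int': "integrable M (\<lambda>x. indicator (D k) x * \<bar>r u x\<bar>)" for k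
    using integrable_mult_indicator[OF D(1) int] by simp
  have "(\<Sum>k\<in>K. norm (restriction (D k) u)) = (\<integral>x. (\<Sum>k\<in>K. indicator (D k) x * \<bar>r u x\<bar>) \<partial>M)"
    using int' by (simp add: norm_restriction D(1))
  also have "\<dots> \<le> (\<integral>x. \<bar>r u x\<bar> \<partial>M)"
  proof (rule integral_mono)
    fix x
    have "(\<Sum>k\<in>K. indicator (D k) x) = (indicator (\<Union>k\<in>K. D k) x :: real)"
      using D(2) \<open>finite K\<close> by (intro indicator_UN_disjoint[symmetric]) (auto simp: disjoint_family_on_def)
    then show "(\<Sum>k\<in>K. indicator (D k) x * \<bar>r u x\<bar>) \<le> \<bar>r u x\<bar>"
      by (simp add: indicator_def flip: sum_distrib_right)
  qed (use int int' in auto)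
  finally show ?thesis by (simp add: norm_rep)
qed

lemma linear_integral_rep: "linear (\<lambda>u. \<integral>x. r u x \<partial>M)"
proof (rule linearI)
  fix u v c
  have "(\<integral>x. r (u + v) x \<partial>M) = (\<integral>x. r u x + r v x \<partial>M)"
    by (rule integral_cong_AE) (use rep_add integrable_rep in auto)
  then show "(\<integral>x. r (u + v) x \<partial>M) = (\<integral>x. r u x \<partial>M) + (\<integral>x. r v x \<partial>M)"
    by (simp add: integrable_rep)
  have "(\<integral>x. r (c *\<^sub>R u) x \<partial>M) = (\<integral>x. c * r u x \<partial>M)"
    by (rule integral_cong_AE) (use rep_scale integrable_rep in auto)
  then show "(\<integral>x. r (c *\<^sub>R u) x \<partial>M) = c *\<^sub>R (\<integral>x. r u x \<partial>M)"
    by simp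
qed

text \<open>For a function of constant sign, the absolute value of the integral is the norm.\<close>

lemma eq_0_if_signed_and_integral_0:
  assumes "(\<integral>x. r h x \<partial>M) = 0" and "(AE x in M. r h x \<le> 0) \<or> (AE x in M. 0 \<le> r h x)"
  shows "h = 0"
  using assms(2)
proof
  assume "AE x in M. r h x \<le> 0"
  then have "(\<integral>x. \<bar>r h x\<bar> \<partial>M) = (\<integral>x. - r h x \<partial>M)"
    using integrable_rep by (intro integral_cong_AE) auto
  then show ?thesis using assms(1) by (simp flip: norm_rep)
next
  assume "AE x in M. 0 \<le> r h x"
  then have "(\<integral>x. \<bar>r h x\<bar> \<partial>M) = (\<integral>x. r h x \<partial>M)"
    using integrable_rep by (intro integral_cong_AE) auto
  then show ?thesis using assms(1) by (simp flip: norm_rep)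
qed

text \<open>The vectors that are supported in \<open>A\<close> form an infinite-dimensional space.\<close>

definition large :: "'b set \<Rightarrow> bool" where
  "large A \<longleftrightarrow> A \<in> sets M \<and> \<not> (\<exists>F. finite F \<and> range (restriction A) \<subseteq> span F)"

text \<open>If the integral were injective on the functions supported in \<open>A\<close>, then these would form a space
  of dimension at most one. So some nonzero \<open>h\<close> supported in \<open>A\<close> has integral 0. It takes
  both signs on nonnull sets, so the set where it is positive splits \<open>A\<close> into two parts that
  carry nonzero functions. One of the parts must be large, and the other one is split off.\<close>

lemma split_large:
  assumes "large A"
  shows "\<exists>B. large B \<and> B \<subseteq> A \<and> (\<exists>u. restriction (A - B) u \<noteq> 0)"
proof -
  have A: "A \<in> sets M" using assms by (simp add: large_def)
  have "subspace (range (restriction A))"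
    by (rule linear_subspace_image[OF linear_restriction[OF A] subspace_UNIV])
  then obtain h where "h \<in> range (restriction A)" and int0: "(\<integral>x. r h x \<partial>M) = 0" and "h \<noteq> 0"
    using finite_span_if_separated_by_finitely_many_functionals
        [of "{\<lambda>u. \<integral>x. r u x \<partial>M}" "range (restriction A)"] linear_integral_rep assms
    unfolding large_def by auto
  then have h: "restriction A h = h" using restriction_idem[OF A] by auto
  have r_h: "AE x in M. r h x = indicator A x * r h x"
    using rep_restriction[OF A, of h] by (simp add: h)
  define B where "B = {x \<in> space M. 0 < r h x} \<inter> A"
  define C where "C = A - B"
  have [measurable]: "r h \<in> borel_measurable M" using integrable_rep by auto
  have B: "B \<in> sets M" "B \<subseteq> A" unfolding B_def using A by auto
  then have C: "C \<in> sets M" "C \<subseteq> A" "A - C = B" unfolding C_def using A by auto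
  have "restriction B h \<noteq> 0"
  proof
    assume "restriction B h = 0"
    then have "AE x in M. r 0 x = indicator B x * r h x" using rep_restriction[OF B(1), of h] by simp
    moreover have "AE x in M. r 0 x = 0" using rep_scale[of 0 0] by simp
    ultimately have "AE x in M. r h x \<le> 0"
      using r_h AE_space by eventually_elim (auto simp: B_def indicator_def split: if_splits)
    then show False using eq_0_if_signed_and_integral_0 int0 \<open>h \<noteq> 0\<close> by blast
  qed
  moreover have "restriction C h \<noteq> 0"
  proof
    assume "restriction C h = 0"
    then have "AE x in M. r 0 x = indicator C x * r h x" using rep_restriction[OF C(1), of h] by simp
    moreover have "AE x in M. r 0 x = 0" using rep_scale[of 0 0] by simp
    ultimately have "AE x in M. 0 \<le> r h x"
      using r_h AE_space by eventually_elim (auto simp: B_def C_def indicator_def split: if_splits)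
    then show False using eq_0_if_signed_and_integral_0 int0 \<open>h \<noteq> 0\<close> by blast
  qed
  moreover have "large B \<or> large C"
  proof (rule ccontr)
    assume "\<not> (large B \<or> large C)"
    then obtain F G where F: "finite F" "range (restriction B) \<subseteq> span F"
      and G: "finite G" "range (restriction C) \<subseteq> span G"
      using B C unfolding large_def by blast
    have "restriction A u \<in> span (F \<union> G)" for u
      unfolding restriction_split[OF A B, of u]
      using F(2) G(2) span_mono[of F "F \<union> G"] span_mono[of G "F \<union> G"]
      by (intro span_add) (auto simp: C_def)
    then show False using assms F(1) G(1) unfolding large_def by blast
  qed
  ultimately show ?thesis using B C C_def by metis
qed

text \<open>The parts that are split off in a repeated splitting of the whole space are disjoint.\<close>

lemma strong_diameter_2_property_dual_L1:
  assumes "infinite_dimensional TYPE('z)"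
  shows "strong_diameter_2_property TYPE('z \<Rightarrow>\<^sub>L real)"
proof -
  have "restriction (space M) = id" using restriction_space by auto
  then have "large (space M)"
    using assms unfolding infinite_dimensional_def large_def by (auto simp: top.extremum_unique)
  then have "\<exists>A. \<forall>n. large (A n) \<and> A (Suc n) \<subseteq> A n \<and> (\<exists>u. restriction (A n - A (Suc n)) u \<noteq> 0)"
    using split_large dependent_nat_choice[of "\<lambda>n A. large A"
        "\<lambda>n A B. B \<subseteq> A \<and> (\<exists>u. restriction (A - B) u \<noteq> 0)"] by blast
  then obtain A where A: "\<And>n. large (A n)" "\<And>n. A (Suc n) \<subseteq> A n"
      "\<And>n. \<exists>u. restriction (A n - A (Suc n)) u \<noteq> 0"
    by blast
  define D where "D n = A n - A (Suc n)" for n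
  have D: "D n \<in> sets M" for n
    using A(1) unfolding D_def large_def by auto
  have "decseq A" using A(2) by (rule decseq_SucI)
  have "disjoint_family D"
    unfolding disjoint_family_on_def
  proof (intro ballI impI)
    have less: "D m \<inter> D n = {}" if "m < n" for m n
      using decseqD[OF \<open>decseq A\<close>, of "Suc m" n] that unfolding D_def by auto
    show "D m \<inter> D n = {}" if "m \<noteq> n" for m n
      using less[of m n] less[of n m] that by (metis Int_commute nat_neq_iff)
  qed
  moreover have "\<exists>u. restriction (D n) u \<noteq> 0" for n
    unfolding D_def by (rule A(3))
  ultimately show ?thesis
    using D
    by (intro strong_diameter_2_property_dual[of "\<lambda>n. restriction (D n)"]
        linear_restriction restriction_idem norm_restriction_split sum_norm_restriction_le)
qed

end

theorem proposition4p6: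
  assumes "lindenstrauss_space TYPE('a::banach) TYPE('b)"
    and "infinite_dimensional TYPE('a)"
  shows "strong_diameter_2_property TYPE(('a \<Rightarrow>\<^sub>L real) \<Rightarrow>\<^sub>L real)
    \<and> strong_diameter_2_property TYPE('a)"
proof -
  obtain M :: "'b measure" and r :: "('a \<Rightarrow>\<^sub>L real) \<Rightarrow> 'b \<Rightarrow> real" where "L1_representation M r"
    using assms(1) isometric_to_L1_representation unfolding lindenstrauss_space_def by blast
  then have "strong_diameter_2_property TYPE(('a \<Rightarrow>\<^sub>L real) \<Rightarrow>\<^sub>L real)"
    by (rule L1_representation.strong_diameter_2_property_dual_L1)
      (rule infinite_dimensional_dual[OF assms(2)])
  then show ?thesis using strong_diameter_2_property_from_bidual by blast
qed

end
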